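(* Let $\{\overline{\mathbf U}_{ij}^n\}$ be the solution of the first-order 2D Lax–Friedrichs type scheme $$\overline{\mathbf U}_{ij}^{n+1}=\overline{\mathbf U}_{ij}^n-\frac{\Delta t_n}{\Delta x}\Big(\hat{\mathbf F}_1(\overline{\mathbf U}_{ij}^n,\overline{\mathbf U}_{i+1,j}^n)-\hat{\mathbf F}_1(\overline{\mathbf U}_{i-1,j}^n,\overline{\mathbf U}_{ij}^n)\Big)-\frac{\Delta t_n}{\Delta y}\Big(\hat{\mathbf F}_2(\overline{\mathbf U}_{ij}^n,\overline{\mathbf U}_{i,j+1}^n)-\hat{\mathbf F}_2(\overline{\mathbf U}_{i,j-1}^n,\overline{\mathbf U}_{ij}^n)\Big),$$ $$\hat{\mathbf F}_k(\mathbf U^-,\mathbf U^+)=\frac12\Big(\mathbf F_k(\mathbf U^-)+\mathbf F_k(\mathbf U^+)-(\mathbf U^+-\mathbf U^-)\Big),\quad k=1,2.$$ If the discrete divergence-free condition $$\mathrm{div}_{ij}\overline{\mathbf B}^n:=\frac{(\overline B_1)_{i+1,j}^n-(\overline B_1)_{i-1,j}^n}{2\Delta x}+\frac{(\overline B_2)_{i,j+1}^n-(\overline B_2)_{i,j-1}^n}{2\Delta y}=0$$ holds for the discrete initial data $\{\overline{\mathbf U}_{ij}^0\}$ (i.e. for $n=0$ and all $i,j$), then it holds for all $n\in\mathbb N$ and all $i,j$.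
   Context: Fix the adiabatic index $\Gamma\in(1,2]$ (equation of state $p=(\Gamma-1)\rho e$; speed of light $c=1$). For primitive variables $\mathbf V=(\rho,\mathbf v,\mathbf B,p)$ with $\rho,p>0$, $\mathbf v,\mathbf B\in\mathbb R^3$, $|\mathbf v|<1$, put $W=(1-|\mathbf v|^2)^{-1/2}$, $e=\frac{p}{(\Gamma-1)\rho}$, $h=1+e+\frac p\rho$, $p_m=\frac12\big(W^{-2}|\mathbf B|^2+(\mathbf v\cdot\mathbf B)^2\big)$, $p_{tot}=p+p_m$. The associated conservative vector is $\mathbf U(\mathbf V)=(D,\mathbf m,\mathbf B,E)^\top\in\mathbb R^8$ with $D=\rho W$, $\mathbf m=\rho hW^2\mathbf v+|\mathbf B|^2\mathbf v-(\mathbf v\cdot\mathbf B)\mathbf B$, $E=\rho hW^2-p_{tot}+|\mathbf B|^2$. The admissible state set is $\mathcal G=\{\mathbf U(\mathbf V): \rho>0,\ p>0,\ |\mathbf v|<1,\ \mathbf B\in\mathbb R^3\}$. Each $\mathbf U\in\mathcal G$ determines its primitive variables, and for $\mathbf U\in\mathcal G$ and $k\in\{1,2,3\}$ the flux is $$\mathbf F_k(\mathbf U)=\Big(Dv_k,\ v_k\mathbf m-B_k\big(W^{-2}\mathbf B+(\mathbf v\cdot\mathbf B)\mathbf v\big)+p_{tot}\mathbf e_k,\ v_k\mathbf B-B_k\mathbf v,\ m_k\Big)^\top,$$ with $\mathbf e_k$ the $k$-th row of the $3\times3$ identity matrix. The mesh is uniform rectangular with step sizes $\Delta x,\Delta y>0$,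 cells are indexed by $(i,j)\in\mathbb Z^2$, $\Delta t_n>0$ is the time step, and $(\overline B_1)_{ij}^n,(\overline B_2)_{ij}^n$ are the fifth and sixth components of $\overline{\mathbf U}_{ij}^n\in\mathbb R^8$. The numerical solution is understood to be well defined, i.e. the values $\overline{\mathbf U}_{ij}^n$ at which the fluxes are evaluated lie in $\mathcal G$. *)

theory Defs
  imports "HOL-Analysis.Analysis"
begin

text \<open>Primitive variables \<open>(\<rho>, v, B, p)\<close> of special relativistic magnetohydrodynamics
  (speed of light 1), for the ideal equation of state with adiabatic index \<open>\<Gamma>\<close>.\<close>

datatype prim =
  Prim (dens: real) (vel: "real ^ 3") (mag: "real ^ 3") (pres: real)

definition prim_adm :: "prim set" where
  "prim_adm = {V. dens V > 0 \<and> pres V > 0 \<and> norm (vel V) < 1}"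

definition lorentz :: "prim \<Rightarrow> real" where
  "lorentz V = 1 / sqrt (1 - (norm (vel V))\<^sup>2)"

definition spec_energy :: "real \<Rightarrow> prim \<Rightarrow> real" where
  "spec_energy \<Gamma> V = pres V / ((\<Gamma> - 1) * dens V)"

definition enthalpy :: "real \<Rightarrow> prim \<Rightarrow> real" where
  "enthalpy \<Gamma> V = 1 + spec_energy \<Gamma> V + pres V / dens V"

definition p_mag :: "prim \<Rightarrow> real" where
  "p_mag V = ((norm (mag V))\<^sup>2 / (lorentz V)\<^sup>2 + (vel V \<bullet> mag V)\<^sup>2) / 2"

definition p_tot :: "prim \<Rightarrow> real" where
  "p_tot V = pres V + p_mag V"

definition cons_D :: "prim \<Rightarrow> real" where
  "cons_D V = dens V * lorentz V"

definition cons_m :: "real \<Rightarrow> prim \<Rightarrow> real ^ 3" where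
  "cons_m \<Gamma> V = (dens V * enthalpy \<Gamma> V * (lorentz V)\<^sup>2) *\<^sub>R vel V
     + (norm (mag V))\<^sup>2 *\<^sub>R vel V - (vel V \<bullet> mag V) *\<^sub>R mag V"

definition cons_E :: "real \<Rightarrow> prim \<Rightarrow> real" where
  "cons_E \<Gamma> V = dens V * enthalpy \<Gamma> V * (lorentz V)\<^sup>2 - p_tot V + (norm (mag V))\<^sup>2"

text \<open>Components are numbered from 1 to 8; the magnetic field occupies components 5, 6 and 7
  (in the index type \<open>8\<close>, the numeral \<open>8\<close> equals \<open>0\<close>).\<close>

definition blocks :: "real \<Rightarrow> real ^ 3 \<Rightarrow> real ^ 3 \<Rightarrow> real \<Rightarrow> real ^ 8" where
  "blocks D m B E = vector [D, m $ 1, m $ 2, m $ 3, B $ 1, B $ 2, B $ 3, E]"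

lemma blocks_nth:
  "blocks D m B E $ 1 = D"
  "blocks D m B E $ 2 = m $ 1" "blocks D m B E $ 3 = m $ 2" "blocks D m B E $ 4 = m $ 3"
  "blocks D m B E $ 5 = B $ 1" "blocks D m B E $ 6 = B $ 2" "blocks D m B E $ 7 = B $ 3"
  "blocks D m B E $ 8 = E"
  by (simp_all add: blocks_def vector_def)

definition cons :: "real \<Rightarrow> prim \<Rightarrow> real ^ 8" where
  "cons \<Gamma> V = blocks (cons_D V) (cons_m \<Gamma> V) (mag V) (cons_E \<Gamma> V)"

definition adm :: "real \<Rightarrow> (real ^ 8) set" where
  "adm \<Gamma> = cons \<Gamma> ` prim_adm"

text \<open>The admissible primitive variables of a conservative vector; meaningful on
  \<open>adm \<Gamma>\<close> only, like the flux below.\<close>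

definition prim_of :: "real \<Rightarrow> real ^ 8 \<Rightarrow> prim" where
  "prim_of \<Gamma> = the_inv_into prim_adm (cons \<Gamma>)"

definition flux :: "real \<Rightarrow> 3 \<Rightarrow> real ^ 8 \<Rightarrow> real ^ 8" where
  "flux \<Gamma> k U =
    (let V = prim_of \<Gamma> U; v = vel V; B = mag V; W = lorentz V; m = cons_m \<Gamma> V
     in blocks
          (cons_D V * v $ k)
          (v $ k *\<^sub>R m - B $ k *\<^sub>R ((1 / W\<^sup>2) *\<^sub>R B + (v \<bullet> B) *\<^sub>R v) + p_tot V *\<^sub>R axis k 1)
          (v $ k *\<^sub>R B - B $ k *\<^sub>R v)
          (m $ k))"

definition lf_flux :: "real \<Rightarrow> 3 \<Rightarrow> real ^ 8 \<Rightarrow> real ^ 8 \<Rightarrow> real ^ 8" where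
  "lf_flux \<Gamma> k Um Up = (1 / 2) *\<^sub>R (flux \<Gamma> k Um + flux \<Gamma> k Up - (Up - Um))"

definition div_B :: "real \<Rightarrow> real \<Rightarrow> (int \<Rightarrow> int \<Rightarrow> real ^ 8) \<Rightarrow> int \<Rightarrow> int \<Rightarrow> real" where
  "div_B \<Delta>x \<Delta>y U i j =
     (U (i + 1) j $ 5 - U (i - 1) j $ 5) / (2 * \<Delta>x)
     + (U i (j + 1) $ 6 - U i (j - 1) $ 6) / (2 * \<Delta>y)"

end

theory Submission
  imports Defs
begin

text \<open>The magnetic rows of the flux come from the induction equation, whose flux matrix
  \<open>v\<^sub>k B\<^sub>l - B\<^sub>k v\<^sub>l\<close> is antisymmetric in \<open>k\<close> and \<open>l\<close>. In two dimensions it reduces to the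
  single scalar \<open>\<Omega> = v\<^sub>1 B\<^sub>2 - B\<^sub>1 v\<^sub>2\<close>: it moves \<open>B\<^sub>2\<close> through the \<open>x\<close>-fluxes, and with opposite
  sign \<open>B\<^sub>1\<close> through the \<open>y\<close>-fluxes, while the remaining two fluxes vanish. What is left of the
  scheme on \<open>(B\<^sub>1, B\<^sub>2)\<close> is a discrete curl of \<open>\<Omega>\<close>, formed with central differences, plus the
  Lax--Friedrichs viscosity.

  The discrete divergence is formed with the same central differences. These commute, so the
  divergence of the discrete curl vanishes identically; and the viscosity, acting on both
  components by the same constant-coefficient stencil, commutes with the divergence. Hence
  the divergence itself evolves by that stencil (lemma \<open>div_B_lf_step\<close>): its new value in a
  cell is a fixed linear combination of the old values in the cell and its four neighbours.
  A divergence that is zero everywhere therefore remains zero.\<close>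

text \<open>The \<open>z\<close>-component of \<open>v \<times> B\<close>, up to sign the electric field of ideal
  magnetohydrodynamics.\<close>

definition induction_flux :: "real \<Rightarrow> real ^ 8 \<Rightarrow> real" where
  "induction_flux \<Gamma> U =
    (let V = prim_of \<Gamma> U in vel V $ 1 * mag V $ 2 - mag V $ 1 * vel V $ 2)"

text \<open>The flux sees the magnetic field only through the recovered primitive variables, so the
  antisymmetry of the flux matrix is an algebraic identity in them.\<close>

lemma flux_magnetic_antisym:
  "flux \<Gamma> 1 U $ 5 = 0" "flux \<Gamma> 1 U $ 6 = induction_flux \<Gamma> U"
  "flux \<Gamma> 2 U $ 5 = - induction_flux \<Gamma> U" "flux \<Gamma> 2 U $ 6 = 0"
  by (simp_all add: flux_def induction_flux_def Let_def blocks_nth algebra_simps)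

lemma lf_flux_magnetic:
  "lf_flux \<Gamma> 1 Um Up $ 5 = (Um $ 5 - Up $ 5) / 2"
  "lf_flux \<Gamma> 1 Um Up $ 6 =
    (induction_flux \<Gamma> Um + induction_flux \<Gamma> Up + Um $ 6 - Up $ 6) / 2"
  "lf_flux \<Gamma> 2 Um Up $ 5 =
    (Um $ 5 - Up $ 5 - induction_flux \<Gamma> Um - induction_flux \<Gamma> Up) / 2"
  "lf_flux \<Gamma> 2 Um Up $ 6 = (Um $ 6 - Up $ 6) / 2"
  by (simp_all add: lf_flux_def flux_magnetic_antisym)

definition lf_step ::
  "real \<Rightarrow> real \<Rightarrow> real \<Rightarrow> real \<Rightarrow> (int \<Rightarrow> int \<Rightarrow> real ^ 8) \<Rightarrow> int \<Rightarrow> int \<Rightarrow> real ^ 8" where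
  "lf_step \<Gamma> \<Delta>x \<Delta>y \<Delta>t U i j = U i j
    - (\<Delta>t / \<Delta>x) *\<^sub>R (lf_flux \<Gamma> 1 (U i j) (U (i + 1) j) - lf_flux \<Gamma> 1 (U (i - 1) j) (U i j))
    - (\<Delta>t / \<Delta>y) *\<^sub>R (lf_flux \<Gamma> 2 (U i j) (U i (j + 1)) - lf_flux \<Gamma> 2 (U i (j - 1)) (U i j))"

text \<open>The time step of the viscous part alone: with \<open>\<alpha> = \<Delta>t / \<Delta>x\<close> and \<open>\<beta> = \<Delta>t / \<Delta>y\<close>, the
  increment is \<open>\<alpha> / 2\<close> and \<open>\<beta> / 2\<close> times the second differences in the two directions.\<close>

definition lf_stencil :: "real \<Rightarrow> real \<Rightarrow> (int \<Rightarrow> int \<Rightarrow> real) \<Rightarrow> int \<Rightarrow> int \<Rightarrow> real" where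
  "lf_stencil \<alpha> \<beta> f i j = (1 - \<alpha> - \<beta>) * f i j
    + \<alpha> / 2 * (f (i + 1) j + f (i - 1) j) + \<beta> / 2 * (f i (j + 1) + f i (j - 1))"

text \<open>The interface value of \<open>\<Omega>\<close> is the mean of the two adjacent cells, so the cell's own value
  drops out of each flux difference. This is what turns the numerical curl into central
  differences, matching those of \<open>div_B\<close>.\<close>

lemma lf_step_magnetic:
  fixes \<Gamma> :: real and U :: "int \<Rightarrow> int \<Rightarrow> real ^ 8"
  defines "\<Omega> \<equiv> \<lambda>i j. induction_flux \<Gamma> (U i j)"
  shows "lf_step \<Gamma> \<Delta>x \<Delta>y \<Delta>t U i j $ 5 =
      lf_stencil (\<Delta>t / \<Delta>x) (\<Delta>t / \<Delta>y) (\<lambda>i j. U i j $ 5) i j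
      + \<Delta>t / \<Delta>y * ((\<Omega> i (j + 1) - \<Omega> i (j - 1)) / 2)"
    and "lf_step \<Gamma> \<Delta>x \<Delta>y \<Delta>t U i j $ 6 =
      lf_stencil (\<Delta>t / \<Delta>x) (\<Delta>t / \<Delta>y) (\<lambda>i j. U i j $ 6) i j
      - \<Delta>t / \<Delta>x * ((\<Omega> (i + 1) j - \<Omega> (i - 1) j) / 2)"
  unfolding lf_step_def lf_stencil_def \<Omega>_def
  by (simp_all add: lf_flux_magnetic diff_divide_distrib add_divide_distrib algebra_simps)

text \<open>The mixed differences of \<open>\<Omega>\<close> enter with the coefficients
  \<open>\<plusminus> \<Delta>t / (4 \<Delta>x \<Delta>y)\<close>, one from each component, and cancel.\<close>

lemma div_B_lf_step:
  "div_B \<Delta>x \<Delta>y (lf_step \<Gamma> \<Delta>x \<Delta>y \<Delta>t U) i j =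
    lf_stencil (\<Delta>t / \<Delta>x) (\<Delta>t / \<Delta>y) (div_B \<Delta>x \<Delta>y U) i j"
  unfolding div_B_def lf_step_magnetic lf_stencil_def
  by (simp add: diff_divide_distrib add_divide_distrib algebra_simps)

theorem theorem3p3:
  fixes \<Gamma> \<Delta>x \<Delta>y :: real
    and \<Delta>t :: "nat \<Rightarrow> real"
    and U :: "nat \<Rightarrow> int \<Rightarrow> int \<Rightarrow> real ^ 8"
  assumes "1 < \<Gamma>" and "\<Gamma> \<le> 2"
    and "\<Delta>x > 0" and "\<Delta>y > 0" and "\<And>n. \<Delta>t n > 0"
    and "\<And>n i j. U n i j \<in> adm \<Gamma>"
    and "\<And>n i j. U (Suc n) i j = U n i j
          - (\<Delta>t n / \<Delta>x) *\<^sub>R (lf_flux \<Gamma> 1 (U n i j) (U n (i + 1) j)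
                          - lf_flux \<Gamma> 1 (U n (i - 1) j) (U n i j))
          - (\<Delta>t n / \<Delta>y) *\<^sub>R (lf_flux \<Gamma> 2 (U n i j) (U n i (j + 1))
                          - lf_flux \<Gamma> 2 (U n i (j - 1)) (U n i j))"
    and "\<And>i j. div_B \<Delta>x \<Delta>y (U 0) i j = 0"
  shows "\<forall>n i j. div_B \<Delta>x \<Delta>y (U n) i j = 0"
proof (rule allI)
  fix n
  show "\<forall>i j. div_B \<Delta>x \<Delta>y (U n) i j = 0"
  proof (induction n)
    case 0
    show ?case using assms(8) by blast
  next
    case (Suc n)
    have "U (Suc n) = lf_step \<Gamma> \<Delta>x \<Delta>y (\<Delta>t n) (U n)"
      by (intro ext) (simp only: assms(7) lf_step_def)
    then show ?case
      using Suc.IH by (simp add: div_B_lf_step lf_stencil_def)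
  qed
qed

end
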